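(* Let $(B_t)_{t\in\mathbb R_+}$ be a Brownian motion on a probability space $(\Omega,\mathcal F,P)$. Then: (1) for every $c>0$, the process $(B_{ct}/\sqrt c)_{t\in\mathbb R_+}$ is a Brownian motion; (2) (weak Markov property) for every $t_0\in\mathbb R_+$, the process $(B_{t_0+t}-B_{t_0})_{t\in\mathbb R_+}$ is a Brownian motion independent of $(B_t)_{t\le t_0}$; (3) the process $(tB_{1/t})_{t\in\mathbb R_+}$ (equal to $0$ at $t=0$) is a Brownian motion; (4) $B_t/t$ tends to $0$ almost surely as $t\to\infty$.
   Context: A real-valued stochastic process $(X_t)_{t\in\mathbb R_+}$ is a Brownian motion if it has continuous paths almost surely and, for all $n\in\mathbb N$ and $t_1,\dots,t_n\in\mathbb R_+=[0,\infty)$, the vector $(X_{t_1},\dots,X_{t_n})$ has a (possibly degenerate) multivariate normal distribution with mean $0$ and covariance matrix $\mathbf{cov}(X_{t_i},X_{t_j})=\min(t_i,t_j)$. Independence of two processes means independence as random elements of the corresponding product spaces with product $\sigma$-algebras. *)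

theory Defs
  imports "HOL-Probability.Probability"
begin

(* The library's normal_density \<mu> 0 is identically 0, so the degenerate normal law with
   standard deviation 0 has to be given separately, as the point mass at \<mu>. *)
definition normal_law :: "real \<Rightarrow> real \<Rightarrow> real measure" where
  "normal_law \<mu> \<sigma> =
     (if \<sigma> = 0 then return borel \<mu> else density lborel (\<lambda>x. ennreal (normal_density \<mu> \<sigma> x)))"

context prob_space
begin

definition covariance :: "('a \<Rightarrow> real) \<Rightarrow> ('a \<Rightarrow> real) \<Rightarrow> real" where
  "covariance X Y = expectation (\<lambda>\<omega>. (X \<omega> - expectation X) * (Y \<omega> - expectation Y))"

(* The vector is (X 0, ..., X (n - 1)). It has a possibly degenerate multivariate normal
   distribution iff every linear combination of its entries has a possibly degenerate
   univariate normal distribution. All entries are then square integrable, so that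
   their expectations and covariances are the genuine ones. *)
definition multivariate_normal :: "nat \<Rightarrow> (nat \<Rightarrow> 'a \<Rightarrow> real) \<Rightarrow> bool" where
  "multivariate_normal n X \<longleftrightarrow>
     (\<forall>i<n. random_variable borel (X i)) \<and>
     (\<forall>a :: nat \<Rightarrow> real. \<exists>\<mu> \<sigma>. \<sigma> \<ge> 0 \<and>
        distr M borel (\<lambda>\<omega>. \<Sum>i<n. a i * X i \<omega>) = normal_law \<mu> \<sigma>)"

(* Time is the half-line {0..}: the values of X at negative times are irrelevant. *)
definition brownian_motion :: "(real \<Rightarrow> 'a \<Rightarrow> real) \<Rightarrow> bool" where
  "brownian_motion X \<longleftrightarrow>
     (\<forall>t\<ge>0. random_variable borel (X t)) \<and>
     (AE \<omega> in M. continuous_on {0..} (\<lambda>t. X t \<omega>)) \<and>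
     (\<forall>(n :: nat) (t :: nat \<Rightarrow> real). (\<forall>i<n. t i \<ge> 0) \<longrightarrow>
        multivariate_normal n (\<lambda>i. X (t i)) \<and>
        (\<forall>i<n. expectation (X (t i)) = 0) \<and>
        (\<forall>i<n. \<forall>j<n. covariance (X (t i)) (X (t j)) = min (t i) (t j)))"

(* Processes (X t) for t in S and (Y t) for t in T, as random elements of the product spaces
   of all real functions on S and on T. *)
definition indep_processes ::
  "real set \<Rightarrow> (real \<Rightarrow> 'a \<Rightarrow> real) \<Rightarrow> real set \<Rightarrow> (real \<Rightarrow> 'a \<Rightarrow> real) \<Rightarrow> bool" where
  "indep_processes S X T Y \<longleftrightarrow>
     indep_var (\<Pi>\<^sub>M t\<in>S. borel) (\<lambda>\<omega>. \<lambda>t\<in>S. X t \<omega>) (\<Pi>\<^sub>M t\<in>T. borel) (\<lambda>\<omega>. \<lambda>t\<in>T. Y t \<omega>)"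

end

end

theory Submission
  imports Defs
begin

text \<open>A process is a Brownian motion iff it has almost surely continuous paths, lies in a space of
  centred Gaussian variables and has covariance \<open>min s t\<close>. The transformed processes stay in the same
  Gaussian space, so only covariances have to be computed. Independence of the increments from the
  past holds because uncorrelated families in a Gaussian space are independent: the pair has the same
  characteristic function as independent copies. For time inversion, continuity at \<open>0\<close> is an
  event about the values at rational times; it has probability one for \<open>B\<close>, hence also for
  \<open>t B(1/t)\<close>, which has the same finite-dimensional laws. The law of large numbers is this
  continuity at \<open>0\<close> read backwards.\<close>

section \<open>Joint laws from characteristic functions\<close>

text \<open>Uniqueness of characteristic functions is applied only on the real line. Joint laws are
  reached through linear spaces of pairs \<open>(f, g)\<close>, with \<open>f\<close> on one
  probability space and \<open>g\<close> on the other, such that \<open>cos (f + \<theta>)\<close>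
  and \<open>cos (g + \<theta>)\<close> have equal integrals for every phase
  \<open>\<theta>\<close>. A real cosine with a phase carries as much as the complex exponential
  (phase \<open>- pi / 2\<close> gives the sine), and adding 1 turns it into a nonnegative weight.
  For centred Gaussian variables this integral depends on the variable only through its second
  moment, so a linear space of pairs qualifies as soon as paired variables have equal second
  moments. Both applications obtain their spaces from orthogonality conditions instead of spans:
  closure under linear combinations is then bilinearity of the expectation of a product.\<close>

lemma char_eq_cos:
  assumes "finite_measure M" and [measurable]: "X \<in> borel_measurable M"
  shows "char (distr M borel X) s = Complex (\<integral>x. cos (s * X x) \<partial>M) (\<integral>x. cos (s * X x - pi / 2) \<partial>M)"
proof -
  interpret finite_measure M by fact
  have int: "complex_integrable M (\<lambda>x. iexp (s * X x))"
    by (rule integrable_const_bound[where B = 1]) (auto simp: norm_exp_i_times)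
  have "char (distr M borel X) s = (CLINT x|M. iexp (s * X x))"
    unfolding char_def by (subst integral_distr) auto
  also have "\<dots> = Complex (\<integral>x. Re (iexp (s * X x)) \<partial>M) (\<integral>x. Im (iexp (s * X x)) \<partial>M)"
    by (rule complex_eqI) (simp_all only: complex.sel integral_Re[OF int] integral_Im[OF int])
  also have "\<dots> = Complex (\<integral>x. cos (s * X x) \<partial>M) (\<integral>x. cos (s * X x - pi / 2) \<partial>M)"
    by (simp add: Re_exp Im_exp cos_diff)
  finally show ?thesis .
qed

text \<open>Dividing by the total weight \<open>c\<close> turns the weighted measures into
  probability measures, under which \<open>X\<close> and \<open>Y\<close> have the same
  characteristic function by the phases 0 and \<open>- pi / 2\<close>. The weights are there to
  carry information about other coordinates while the law of one coordinate is compared. If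
  \<open>c = 0\<close>, both weights vanish almost everywhere.\<close>

lemma weighted_char_unique:
  fixes w :: "'a \<Rightarrow> real" and v :: "'b \<Rightarrow> real"
  assumes "finite_measure M" "finite_measure N"
    and [measurable]: "X \<in> borel_measurable M" "Y \<in> borel_measurable N"
      "w \<in> borel_measurable M" "v \<in> borel_measurable N" "A \<in> sets borel"
    and w: "\<And>x. 0 \<le> w x" "\<And>x. w x \<le> K" and v: "\<And>x. 0 \<le> v x" "\<And>x. v x \<le> K"
    and eq: "\<And>s \<theta>. (\<integral>x. w x * cos (s * X x + \<theta>) \<partial>M) = (\<integral>y. v y * cos (s * Y y + \<theta>) \<partial>N)"
  shows "(\<integral>x. w x * indicator A (X x) \<partial>M) = (\<integral>y. v y * indicator A (Y y) \<partial>N)"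
proof -
  interpret M: finite_measure M by fact
  interpret N: finite_measure N by fact
  have iw: "integrable M w" and iv: "integrable N v"
    by (rule M.integrable_const_bound[where B = K] N.integrable_const_bound[where B = K];
        use w v in \<open>auto simp: abs_of_nonneg\<close>)+
  define c where "c = (\<integral>x. w x \<partial>M)"
  \<comment> \<open>At \<open>s = 0\<close> and phase 0 the cosine is 1, so the total weights agree
    and one normalising constant serves both sides.\<close>
  have c: "c = (\<integral>y. v y \<partial>N)"
    using eq[of 0 0] by (simp add: c_def)
  have c0: "c \<ge> 0" using w by (simp add: c_def)
  show ?thesis
  proof (cases "c = 0")
    case True
    have "AE x in M. w x = 0" "AE y in N. v y = 0"
      using integral_nonneg_eq_0_iff_AE[OF iw] integral_nonneg_eq_0_iff_AE[OF iv] w v True c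
      by (auto simp: c_def)
    then have "(\<integral>x. w x * indicator A (X x) \<partial>M) = (\<integral>x. 0 \<partial>M)"
      "(\<integral>y. v y * indicator A (Y y) \<partial>N) = (\<integral>y. 0 \<partial>N)"
      by (intro integral_cong_AE; auto)+
    then show ?thesis by simp
  next
    case False
    with c0 have cpos: "c > 0" by simp
    let ?M = "density M (\<lambda>x. ennreal (w x / c))" and ?N = "density N (\<lambda>y. ennreal (v y / c))"
    have PM: "prob_space ?M"
      using w cpos
      by (auto intro!: prob_spaceI simp: emeasure_density nn_integral_eq_integral iw c_def[symmetric])
    have PN: "prob_space ?N"
      using v cpos
      by (auto intro!: prob_spaceI simp: emeasure_density nn_integral_eq_integral iv c[symmetric])
    have iM: "(\<integral>x. f (X x) \<partial>?M) = (\<integral>x. w x * f (X x) \<partial>M) / c"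
      if [measurable]: "f \<in> borel_measurable borel" for f :: "real \<Rightarrow> real"
      using w cpos by (subst integral_density) auto
    have iN: "(\<integral>y. f (Y y) \<partial>?N) = (\<integral>y. v y * f (Y y) \<partial>N) / c"
      if [measurable]: "f \<in> borel_measurable borel" for f :: "real \<Rightarrow> real"
      using v cpos by (subst integral_density) auto
    have "(\<integral>x. cos (s * X x + \<theta>) \<partial>?M) = (\<integral>y. cos (s * Y y + \<theta>) \<partial>?N)" for s \<theta>
      using iM[of "\<lambda>x. cos (s * x + \<theta>)"] iN[of "\<lambda>x. cos (s * x + \<theta>)"] eq[of s \<theta>] by simp
    from this[of _ 0] this[of _ "- pi / 2"]
    have "char (distr ?M borel X) = char (distr ?N borel Y)"
      by (intro ext) (simp add: char_eq_cos prob_space.finite_measure PM PN)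
    then have eqd: "distr ?M borel X = distr ?N borel Y"
      by (intro Levy_uniqueness) (auto intro!: prob_space.real_distribution_distr PM PN)
    have "(\<integral>x. indicator A (X x) \<partial>?M) = (\<integral>z. indicat_real A z \<partial>distr ?M borel X)"
      by (subst integral_distr) auto
    also have "\<dots> = (\<integral>y. indicator A (Y y) \<partial>?N)"
      unfolding eqd by (subst integral_distr) auto
    finally show ?thesis
      using iM[of "indicator A"] iN[of "indicator A"] cpos by simp
  qed
qed

text \<open>Weights of the form \<open>1 + cos\<close> are nonnegative, so univariate uniqueness for weighted
  measures replaces the characters of the joint law by indicators one coordinate at a time.\<close>

lemma joint_law_eqI:
  fixes V :: "(('a \<Rightarrow> real) \<times> ('b \<Rightarrow> real)) set"
    and X :: "'i \<Rightarrow> 'a \<Rightarrow> real" and Y :: "'i \<Rightarrow> 'b \<Rightarrow> real"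
  assumes "prob_space M" "prob_space N"
    and V_add: "\<And>f g f' g'. (f, g) \<in> V \<Longrightarrow> (f', g') \<in> V \<Longrightarrow> (\<lambda>x. f x + f' x, \<lambda>y. g y + g' y) \<in> V"
    and V_scale: "\<And>f g c. (f, g) \<in> V \<Longrightarrow> (\<lambda>x. c * f x, \<lambda>y. c * g y) \<in> V"
    and V_meas: "\<And>f g. (f, g) \<in> V \<Longrightarrow> f \<in> borel_measurable M \<and> g \<in> borel_measurable N"
    and V_cos: "\<And>f g \<theta>. (f, g) \<in> V \<Longrightarrow> (\<integral>x. cos (f x + \<theta>) \<partial>M) = (\<integral>y. cos (g y + \<theta>) \<partial>N)"
    and "finite J" "\<And>j. j \<in> J \<Longrightarrow> (X j, Y j) \<in> V" "\<And>j. j \<in> J \<Longrightarrow> A j \<in> sets borel"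
  shows "measure M {x\<in>space M. \<forall>j\<in>J. X j x \<in> A j} = measure N {y\<in>space N. \<forall>j\<in>J. Y j y \<in> A j}"
proof -
  interpret M: prob_space M by fact
  interpret N: prob_space N by fact
  \<comment> \<open>Indicators account for the coordinates already treated, the cosine for all
    remaining linear combinations. The pair and the phase must stay arbitrary, since the step for
    \<open>k\<close> uses the hypothesis at \<open>f\<close> plus and minus multiples of
    \<open>X k\<close>.\<close>
  have int_cos: "(\<integral>x. (\<Prod>j\<in>J. indicator (A j) (X j x)) * cos (f x + \<theta>) \<partial>M) =
     (\<integral>y. (\<Prod>j\<in>J. indicator (A j) (Y j y)) * cos (g y + \<theta>) \<partial>N)" if "(f, g) \<in> V" for f g \<theta>
    using assms(7-9) that
  proof (induction J arbitrary: f g \<theta>)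
    case empty
    then show ?case using V_cos by simp
  next
    case (insert k J)
    have XkV: "(X k, Y k) \<in> V" and [measurable]: "A k \<in> sets borel" using insert by auto
    have [measurable]: "X k \<in> borel_measurable M" "Y k \<in> borel_measurable N"
      "f \<in> borel_measurable M" "g \<in> borel_measurable N"
      using V_meas[OF XkV] V_meas[OF insert.prems(3)] by auto
    have [measurable]: "j \<in> J \<Longrightarrow> A j \<in> sets borel" "j \<in> J \<Longrightarrow> X j \<in> borel_measurable M"
      "j \<in> J \<Longrightarrow> Y j \<in> borel_measurable N" for j
      using V_meas insert.prems by auto
    define p where "p x = (\<Prod>j\<in>J. indicator (A j) (X j x) :: real)" for x
    define q where "q y = (\<Prod>j\<in>J. indicator (A j) (Y j y) :: real)" for y
    have [measurable]: "p \<in> borel_measurable M" "q \<in> borel_measurable N"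
      unfolding p_def q_def by measurable
    have p: "0 \<le> p x" "p x \<le> 1" for x
      unfolding p_def by (auto intro!: prod_nonneg prod_le_1)
    have q: "0 \<le> q x" "q x \<le> 1" for x
      unfolding q_def by (auto intro!: prod_nonneg prod_le_1)
    have IH: "(\<integral>x. p x * cos (f x + \<theta>) \<partial>M) = (\<integral>y. q y * cos (g y + \<theta>) \<partial>N)"
      if "(f, g) \<in> V" for f g \<theta>
      unfolding p_def q_def using insert that by auto
    have iM: "integrable M (\<lambda>x. p x * h x)" if "h \<in> borel_measurable M" "\<And>x. \<bar>h x\<bar> \<le> 2" for h
    proof (rule M.integrable_const_bound[where B = 2])
      have "p x * \<bar>h x\<bar> \<le> 1 * 2" for x
        using that p by (intro mult_mono) auto
      then show "AE x in M. norm (p x * h x) \<le> 2"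
        using p by (simp add: abs_mult)
    qed (use that in measurable)
    have iN: "integrable N (\<lambda>x. q x * h x)" if "h \<in> borel_measurable N" "\<And>x. \<bar>h x\<bar> \<le> 2" for h
    proof (rule N.integrable_const_bound[where B = 2])
      have "q x * \<bar>h x\<bar> \<le> 1 * 2" for x
        using that q by (intro mult_mono) auto
      then show "AE x in N. norm (q x * h x) \<le> 2"
        using q by (simp add: abs_mult)
    qed (use that in measurable)
    have b2: "\<bar>cos (z::real)\<bar> \<le> 2" for z
      using abs_cos_le_one[of z] by linarith
    \<comment> \<open>Product-to-sum: a weight \<open>1 + cos a\<close> tested against
      \<open>cos b\<close> becomes three plain cosines, each covered by the induction
      hypothesis.\<close>
    have cos3: "(1 + cos a) * cos b = cos b + 1/2 * cos (a + b) + 1/2 * cos (a - b)" for a b :: real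
      by (simp add: cos_add cos_diff algebra_simps)
    have w0: "(\<integral>x. p x * indicator (A k) (X k x) \<partial>M) = (\<integral>y. q y * indicator (A k) (Y k y) \<partial>N)"
      by (rule weighted_char_unique[where K = 1])
         (auto simp: p q M.finite_measure_axioms N.finite_measure_axioms intro!: IH V_scale XkV)
    have w1: "(\<integral>x. (p x * (1 + cos (f x + \<theta>))) * indicator (A k) (X k x) \<partial>M) =
      (\<integral>y. (q y * (1 + cos (g y + \<theta>))) * indicator (A k) (Y k y) \<partial>N)" for \<theta>
    proof (rule weighted_char_unique[where K = 2])
      show "0 \<le> p x * (1 + cos (f x + \<theta>))" for x
        using p[of x] cos_ge_minus_one[of "f x + \<theta>"] by (intro mult_nonneg_nonneg) linarith+
      show "0 \<le> q x * (1 + cos (g x + \<theta>))" for x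
        using q[of x] cos_ge_minus_one[of "g x + \<theta>"] by (intro mult_nonneg_nonneg) linarith+
      show "p x * (1 + cos (f x + \<theta>)) \<le> 2" for x
        using p[of x] cos_ge_minus_one[of "f x + \<theta>"] cos_le_one[of "f x + \<theta>"] mult_mono[of "p x" 1 "1 + cos (f x + \<theta>)" 2] by linarith
      show "q x * (1 + cos (g x + \<theta>)) \<le> 2" for x
        using q[of x] cos_ge_minus_one[of "g x + \<theta>"] cos_le_one[of "g x + \<theta>"] mult_mono[of "q x" 1 "1 + cos (g x + \<theta>)" 2] by linarith
      fix s \<phi>
      have V1: "(\<lambda>x. s * X k x, \<lambda>y. s * Y k y) \<in> V"
        by (intro V_scale XkV)
      have V2: "(\<lambda>x. f x + s * X k x, \<lambda>y. g y + s * Y k y) \<in> V"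
        by (intro V_add V1 insert.prems)
      have V3: "(\<lambda>x. f x + (-1) * (s * X k x), \<lambda>y. g y + (-1) * (s * Y k y)) \<in> V"
        by (intro V_add V_scale[OF V1] insert.prems)
      have "(\<integral>x. p x * (1 + cos (f x + \<theta>)) * cos (s * X k x + \<phi>) \<partial>M) =
         (\<integral>x. p x * cos (s * X k x + \<phi>) + 1/2 * (p x * cos (f x + s * X k x + (\<theta> + \<phi>)))
            + 1/2 * (p x * cos (f x + (-1) * (s * X k x) + (\<theta> - \<phi>))) \<partial>M)"
        by (intro Bochner_Integration.integral_cong refl) (simp only: mult.assoc cos3, simp add: algebra_simps)
      also have "\<dots> = (\<integral>x. p x * cos (s * X k x + \<phi>) \<partial>M) + 1/2 * (\<integral>x. p x * cos (f x + s * X k x + (\<theta> + \<phi>)) \<partial>M)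
            + 1/2 * (\<integral>x. p x * cos (f x + (-1) * (s * X k x) + (\<theta> - \<phi>)) \<partial>M)"
        using b2 iM by (subst Bochner_Integration.integral_add) (auto intro!: Bochner_Integration.integrable_add integrable_mult_right)
      also have "\<dots> = (\<integral>x. q x * cos (s * Y k x + \<phi>) \<partial>N) + 1/2 * (\<integral>x. q x * cos (g x + s * Y k x + (\<theta> + \<phi>)) \<partial>N)
            + 1/2 * (\<integral>x. q x * cos (g x + (-1) * (s * Y k x) + (\<theta> - \<phi>)) \<partial>N)"
        by (simp only: IH[OF V1] IH[OF V2] IH[OF V3])
      also have "\<dots> = (\<integral>x. q x * cos (s * Y k x + \<phi>) + 1/2 * (q x * cos (g x + s * Y k x + (\<theta> + \<phi>)))
            + 1/2 * (q x * cos (g x + (-1) * (s * Y k x) + (\<theta> - \<phi>))) \<partial>N)"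
        using b2 iN by (subst Bochner_Integration.integral_add) (auto intro!: Bochner_Integration.integrable_add integrable_mult_right)
      also have "\<dots> = (\<integral>x. q x * (1 + cos (g x + \<theta>)) * cos (s * Y k x + \<phi>) \<partial>N)"
        by (intro Bochner_Integration.integral_cong refl) (simp only: mult.assoc cos3, simp add: algebra_simps)
      finally show "(\<integral>x. p x * (1 + cos (f x + \<theta>)) * cos (s * X k x + \<phi>) \<partial>M) =
        (\<integral>x. q x * (1 + cos (g x + \<theta>)) * cos (s * Y k x + \<phi>) \<partial>N)" .
    qed (auto simp: M.finite_measure_axioms N.finite_measure_axioms)
    have b2': "\<bar>indicator (A k) z :: real\<bar> \<le> 2" "\<bar>indicator (A k) z * cos y :: real\<bar> \<le> 2" for z y
      using b2 by (auto simp: indicator_def)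
    \<comment> \<open>The signed weight \<open>p * cos\<close> is the difference of the nonnegative
      weights \<open>p * (1 + cos)\<close> and \<open>p\<close>, treated in \<open>w1\<close> and
      \<open>w0\<close>.\<close>
    have "(\<integral>x. (\<Prod>j\<in>insert k J. indicator (A j) (X j x)) * cos (f x + \<theta>) \<partial>M) =
      (\<integral>x. (p x * (1 + cos (f x + \<theta>))) * indicator (A k) (X k x) - p x * indicator (A k) (X k x) \<partial>M)"
      using insert by (intro Bochner_Integration.integral_cong refl) (simp add: p_def[symmetric] algebra_simps)
    also have "\<dots> = (\<integral>x. (p x * (1 + cos (f x + \<theta>))) * indicator (A k) (X k x) \<partial>M) - (\<integral>x. p x * indicator (A k) (X k x) \<partial>M)"
      using Bochner_Integration.integrable_add[OF iM iM, of "\<lambda>x. indicator (A k) (X k x)" "\<lambda>x. indicator (A k) (X k x) * cos (f x + \<theta>)"] b2'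
      by (intro Bochner_Integration.integral_diff) (auto simp: algebra_simps intro!: iM)
    also have "\<dots> = (\<integral>x. (q x * (1 + cos (g x + \<theta>))) * indicator (A k) (Y k x) \<partial>N) - (\<integral>x. q x * indicator (A k) (Y k x) \<partial>N)"
      by (simp only: w0 w1)
    also have "\<dots> = (\<integral>x. (q x * (1 + cos (g x + \<theta>))) * indicator (A k) (Y k x) - q x * indicator (A k) (Y k x) \<partial>N)"
      using Bochner_Integration.integrable_add[OF iN iN, of "\<lambda>x. indicator (A k) (Y k x)" "\<lambda>x. indicator (A k) (Y k x) * cos (g x + \<theta>)"] b2'
      by (intro Bochner_Integration.integral_diff[symmetric]) (auto simp: algebra_simps intro!: iN)
    also have "\<dots> = (\<integral>x. (\<Prod>j\<in>insert k J. indicator (A j) (Y j x)) * cos (g x + \<theta>) \<partial>N)"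
      using insert by (intro Bochner_Integration.integral_cong refl) (simp add: q_def[symmetric] algebra_simps)
    finally show ?case .
  qed
  show ?thesis
  proof (cases "J = {}")
    case True
    then show ?thesis by (simp add: M.prob_space N.prob_space)
  next
    case False
    then obtain k where "k \<in> J" by auto
    \<comment> \<open>At the zero pair and phase 0 the cosine is 1, which leaves the bare
      indicators. The zero pair comes from scaling some \<open>(X k, Y k)\<close> by 0, hence the
      separate case of empty \<open>J\<close>.\<close>
    have z: "(\<lambda>x. 0, \<lambda>y. 0) \<in> V"
      using V_scale[OF assms(8)[OF \<open>k \<in> J\<close>], of 0] by simp
    have *: "(\<Prod>j\<in>J. indicator (A j) (Z j z)) = (indicator {x. \<forall>j\<in>J. Z j x \<in> A j} z :: real)" for Z :: "'i \<Rightarrow> 'c \<Rightarrow> real" and z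
      using \<open>finite J\<close> by (auto simp: indicator_def)
    have "(\<integral>x. indicator {x. \<forall>j\<in>J. X j x \<in> A j} x \<partial>M) = (\<integral>y. indicator {y. \<forall>j\<in>J. Y j y \<in> A j} y \<partial>N :: real)"
      using int_cos[OF z, of 0] unfolding * by simp
    then show ?thesis
      by (simp add: Int_def conj_commute)
  qed
qed

section \<open>Gaussian spaces\<close>

lemma normal_law_space [simp]: "sets (normal_law \<mu> \<sigma>) = sets borel" "space (normal_law \<mu> \<sigma>) = UNIV"
  by (auto simp: normal_law_def)

lemma integrable_return:
  fixes f :: "'a \<Rightarrow> real"
  assumes "x \<in> space N" and [measurable]: "f \<in> borel_measurable N"
  shows "integrable (return N x) f"
proof -
  interpret prob_space "return N x"
    by (rule prob_space_return) fact
  have "AE y in return N x. f y = f x"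
    using assms(1) by (subst AE_return) auto
  then have "integrable (return N x) f \<longleftrightarrow> integrable (return N x) (\<lambda>_. f x)"
    using assms by (intro integrable_cong_AE) auto
  then show ?thesis by simp
qed

lemma normal_law_mean:
  assumes "\<sigma> \<ge> 0"
  shows "has_bochner_integral (normal_law \<mu> \<sigma>) (\<lambda>x. x) \<mu>"
proof (cases "\<sigma> = 0")
  case True
  then show ?thesis
    by (simp add: normal_law_def has_bochner_integral_iff integral_return integrable_return)
next
  case False
  then show ?thesis
    using assms normal_moment_nz_1[of \<sigma> \<mu>]
    by (simp add: normal_law_def has_bochner_integral_iff integral_density integrable_density)
qed

lemma normal_law_second_moment:
  assumes "\<sigma> \<ge> 0"
  shows "has_bochner_integral (normal_law 0 \<sigma>) (\<lambda>x. x\<^sup>2) (\<sigma>\<^sup>2)"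
proof (cases "\<sigma> = 0")
  case True
  then show ?thesis
    by (simp add: normal_law_def has_bochner_integral_iff integral_return integrable_return)
next
  case False
  then show ?thesis
    using assms normal_moment_even[of \<sigma> 0 1]
    by (simp add: normal_law_def has_bochner_integral_iff integral_density integrable_density)
qed

lemma normal_law_scale_std:
  assumes "\<sigma> > 0"
  shows "normal_law 0 \<sigma> = distr std_normal_distribution borel (\<lambda>x. \<sigma> * x)"
proof -
  interpret std: prob_space std_normal_distribution
    by (rule prob_space_normal_density) simp
  have "distributed std_normal_distribution lborel (\<lambda>x. x) std_normal_density"
    by (auto simp: distributed_def distr_id2)
  then have "distributed std_normal_distribution lborel (\<lambda>x. 0 + \<sigma> * x) (normal_density (0 + \<sigma> * 0) (\<bar>\<sigma>\<bar> * 1))"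
    using assms by (intro std.normal_density_affine) auto
  then have "distr std_normal_distribution lborel (\<lambda>x. \<sigma> * x) = density lborel (normal_density 0 \<sigma>)"
    using assms by (simp add: distributed_def)
  moreover have "distr std_normal_distribution lborel (\<lambda>x. \<sigma> * x) = distr std_normal_distribution borel (\<lambda>x. \<sigma> * x)"
    by (intro distr_cong) auto
  ultimately show ?thesis
    using assms by (simp add: normal_law_def)
qed

text \<open>After rescaling to the standard normal law, the addition formula leaves a cosine and a
  sine integral. These are the real and imaginary parts of the characteristic function at
  \<open>\<sigma>\<close>, which is the real number
  \<open>exp (- \<sigma>\<^sup>2 / 2)\<close>.\<close>

lemma normal_law_cos:
  assumes "\<sigma> \<ge> 0"
  shows "(\<integral>x. cos (x + \<theta>) \<partial>normal_law 0 \<sigma>) = cos \<theta> * exp (- \<sigma>\<^sup>2 / 2)"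
proof (cases "\<sigma> = 0")
  case True
  then show ?thesis by (simp add: normal_law_def integral_return)
next
  case False
  with assms have \<sigma>: "\<sigma> > 0" by simp
  interpret std: prob_space std_normal_distribution
    by (rule prob_space_normal_density) simp
  have int: "integrable std_normal_distribution (\<lambda>x. cos (\<sigma> * x + c))" for c
    by (rule std.integrable_const_bound[where B = 1]) auto
  have "char (distr std_normal_distribution borel (\<lambda>x. x)) \<sigma> = exp (- \<sigma>\<^sup>2 / 2)"
    by (simp add: distr_id2 char_std_normal_distribution)
  then have *: "(\<integral>x. cos (\<sigma> * x) \<partial>std_normal_distribution) = exp (- \<sigma>\<^sup>2 / 2)"
    "(\<integral>x. cos (\<sigma> * x + - pi / 2) \<partial>std_normal_distribution) = 0"
    by (simp_all add: char_eq_cos std.finite_measure_axioms complex_eq_iff)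
  have "(\<integral>x. cos (x + \<theta>) \<partial>normal_law 0 \<sigma>) = (\<integral>x. cos (\<sigma> * x + \<theta>) \<partial>std_normal_distribution)"
    unfolding normal_law_scale_std[OF \<sigma>] by (subst integral_distr) auto
  also have "\<dots> = (\<integral>x. cos \<theta> * cos (\<sigma> * x + 0) - sin \<theta> * cos (\<sigma> * x + - pi / 2) \<partial>std_normal_distribution)"
    by (intro Bochner_Integration.integral_cong refl) (simp add: cos_add cos_diff algebra_simps)
  also have "\<dots> = cos \<theta> * exp (- \<sigma>\<^sup>2 / 2)"
    by (subst Bochner_Integration.integral_diff[OF integrable_mult_right[OF int] integrable_mult_right[OF int]])
      (simp only: integral_mult_right_zero, simp add: *[simplified])
  finally show ?thesis .
qed

text \<open>Linearity is what makes every finite family in \<open>V\<close> jointly Gaussian: all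
  its linear combinations have a normal law. Since everything is centred, the covariance is the
  inner product given by the expectation of the product. \<open>\<sigma> = 0\<close> is allowed so
  that the zero variable belongs to \<open>V\<close>.\<close>

locale gaussian_space = prob_space M for M :: "'a measure" +
  fixes V :: "('a \<Rightarrow> real) set"
  assumes zero: "(\<lambda>_. 0) \<in> V"
    and add: "\<And>f g. f \<in> V \<Longrightarrow> g \<in> V \<Longrightarrow> (\<lambda>\<omega>. f \<omega> + g \<omega>) \<in> V"
    and scale: "\<And>f c. f \<in> V \<Longrightarrow> (\<lambda>\<omega>. c * f \<omega>) \<in> V"
    and measurable: "\<And>f. f \<in> V \<Longrightarrow> f \<in> borel_measurable M"
    and law: "\<And>f. f \<in> V \<Longrightarrow> \<exists>\<sigma>\<ge>0. distr M borel f = normal_law 0 \<sigma>"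
begin

lemma integrable_square: "f \<in> V \<Longrightarrow> integrable M (\<lambda>\<omega>. (f \<omega>)\<^sup>2)"
  using law[of f] measurable[of f] integrable.intros[OF normal_law_second_moment] integrable_distr[of f M borel "\<lambda>x. x\<^sup>2"]
  by auto

lemma integrable_mult:
  assumes "f \<in> V" "g \<in> V"
  shows "integrable M (\<lambda>\<omega>. f \<omega> * g \<omega>)"
proof (rule Bochner_Integration.integrable_bound)
  show "integrable M (\<lambda>\<omega>. (f \<omega>)\<^sup>2 + (g \<omega>)\<^sup>2)"
    by (intro Bochner_Integration.integrable_add integrable_square assms)
  show "(\<lambda>\<omega>. f \<omega> * g \<omega>) \<in> borel_measurable M"
    using measurable assms by measurable
  have "\<bar>a * b\<bar> \<le> a\<^sup>2 + b\<^sup>2" for a b :: real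
  proof -
    have "2 * (\<bar>a\<bar> * \<bar>b\<bar>) \<le> a\<^sup>2 + b\<^sup>2" "0 \<le> \<bar>a\<bar> * \<bar>b\<bar>"
      using sum_squares_bound[of "\<bar>a\<bar>" "\<bar>b\<bar>"] by (simp_all add: mult.assoc)
    then show ?thesis unfolding abs_mult by linarith
  qed
  then show "AE \<omega> in M. norm (f \<omega> * g \<omega>) \<le> norm ((f \<omega>)\<^sup>2 + (g \<omega>)\<^sup>2)"
    by simp
qed

lemma expectation_eq_0:
  assumes "f \<in> V"
  shows "expectation f = 0"
proof -
  obtain \<sigma> where \<sigma>: "\<sigma> \<ge> 0" "distr M borel f = normal_law 0 \<sigma>"
    using law[OF assms] by auto
  have "expectation f = (\<integral>x. x \<partial>distr M borel f)"
    using measurable[OF assms] by (subst integral_distr) auto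
  then show ?thesis using \<sigma> has_bochner_integral_integral_eq[OF normal_law_mean] by simp
qed

text \<open>This reduces the comparison of cosine integrals to second moments; the phase is kept
  free so that another variable, frozen by Fubini, can be absorbed into it.\<close>

lemma expectation_cos:
  assumes "f \<in> V"
  shows "expectation (\<lambda>\<omega>. cos (f \<omega> + \<theta>)) = cos \<theta> * exp (- expectation (\<lambda>\<omega>. (f \<omega>)\<^sup>2) / 2)"
proof -
  obtain \<sigma> where \<sigma>: "\<sigma> \<ge> 0" "distr M borel f = normal_law 0 \<sigma>"
    using law[OF assms] by auto
  have "expectation (\<lambda>\<omega>. cos (f \<omega> + \<theta>)) = (\<integral>x. cos (x + \<theta>) \<partial>distr M borel f)"
    "expectation (\<lambda>\<omega>. (f \<omega>)\<^sup>2) = (\<integral>x. x\<^sup>2 \<partial>distr M borel f)"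
    using measurable[OF assms] by (subst integral_distr; auto)+
  then show ?thesis using \<sigma> normal_law_cos has_bochner_integral_integral_eq[OF normal_law_second_moment] by simp
qed

lemma minus: "f \<in> V \<Longrightarrow> g \<in> V \<Longrightarrow> (\<lambda>\<omega>. f \<omega> - g \<omega>) \<in> V"
  using add[of f "\<lambda>\<omega>. -1 * g \<omega>"] scale[of g "-1"] by simp

lemma expectation_add_mult:
  "f \<in> V \<Longrightarrow> g \<in> V \<Longrightarrow> h \<in> V \<Longrightarrow>
    expectation (\<lambda>\<omega>. (f \<omega> + g \<omega>) * h \<omega>) = expectation (\<lambda>\<omega>. f \<omega> * h \<omega>) + expectation (\<lambda>\<omega>. g \<omega> * h \<omega>)"
  by (simp add: distrib_right integrable_mult)

lemma expectation_minus_mult: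
  "f \<in> V \<Longrightarrow> g \<in> V \<Longrightarrow> h \<in> V \<Longrightarrow>
    expectation (\<lambda>\<omega>. (f \<omega> - g \<omega>) * h \<omega>) = expectation (\<lambda>\<omega>. f \<omega> * h \<omega>) - expectation (\<lambda>\<omega>. g \<omega> * h \<omega>)"
  by (simp add: left_diff_distrib integrable_mult)

lemma expectation_add_square:
  assumes "f \<in> V" "g \<in> V"
  shows "expectation (\<lambda>\<omega>. (f \<omega> + g \<omega>)\<^sup>2) =
    expectation (\<lambda>\<omega>. (f \<omega>)\<^sup>2) + 2 * expectation (\<lambda>\<omega>. f \<omega> * g \<omega>) + expectation (\<lambda>\<omega>. (g \<omega>)\<^sup>2)"
proof -
  have "expectation (\<lambda>\<omega>. (f \<omega> + g \<omega>)\<^sup>2) =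
    expectation (\<lambda>\<omega>. (f \<omega>)\<^sup>2 + 2 * (f \<omega> * g \<omega>) + (g \<omega>)\<^sup>2)"
    by (intro Bochner_Integration.integral_cong refl) (simp add: power2_sum)
  also have "\<dots> = expectation (\<lambda>\<omega>. (f \<omega>)\<^sup>2) + expectation (\<lambda>\<omega>. 2 * (f \<omega> * g \<omega>)) +
      expectation (\<lambda>\<omega>. (g \<omega>)\<^sup>2)"
    by (simp add: integrable_mult integrable_square assms del: integral_mult_right_zero)
  finally show ?thesis by simp
qed

end

section \<open>Brownian motion as a process in a Gaussian space\<close>

lemma (in prob_space) brownian_motion_gaussian_space:
  assumes "brownian_motion X"
  shows "\<exists>V. gaussian_space M V \<and> (\<forall>t\<ge>0. X t \<in> V)"
proof -
  \<comment> \<open>The linear span of the process. Times may repeat, so a sum of two elements is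
    obtained by concatenating their lists of coefficients and times.\<close>
  define V where "V = {\<lambda>\<omega>. \<Sum>i<n. a i * X (t i) \<omega> | n (a :: nat \<Rightarrow> real) t. \<forall>i<n. t i \<ge> 0}"
  have VI: "(\<lambda>\<omega>. \<Sum>i<n. a i * X (t i) \<omega>) \<in> V" if "\<forall>i<n. t i \<ge> 0" for n :: nat and a t
    unfolding V_def mem_Collect_eq using that by (intro exI conjI) (rule refl, assumption)
  have "gaussian_space M V"
  proof
    show "(\<lambda>_. 0) \<in> V" using VI[of 0] by simp
    fix f g :: "'a \<Rightarrow> real" and c :: real
    assume "f \<in> V"
    then obtain n :: nat and a t where f: "f = (\<lambda>\<omega>. \<Sum>i<n. a i * X (t i) \<omega>)" and t: "\<forall>i<n. t i \<ge> (0::real)"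
      unfolding V_def by blast
    have "(\<lambda>\<omega>. c * f \<omega>) = (\<lambda>\<omega>. \<Sum>i<n. (c * a i) * X (t i) \<omega>)"
      by (simp add: f sum_distrib_left mult.assoc)
    then show "(\<lambda>\<omega>. c * f \<omega>) \<in> V"
      using VI[OF t, of "\<lambda>i. c * a i"] by simp
    have mn: "multivariate_normal n (\<lambda>i. X (t i))" and e0: "\<forall>i<n. expectation (X (t i)) = 0"
      using assms t unfolding brownian_motion_def by blast+
    have [measurable]: "i < n \<Longrightarrow> X (t i) \<in> borel_measurable M" for i
      using mn by (auto simp: multivariate_normal_def)
    show meas [measurable]: "f \<in> borel_measurable M"
      unfolding f by measurable
    obtain \<mu> \<sigma> where \<sigma>: "\<sigma> \<ge> 0" "distr M borel f = normal_law \<mu> \<sigma>"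
      using mn unfolding multivariate_normal_def f by blast
    \<comment> \<open>Integrability of each term is needed to pull the expectation through the sum
      and conclude \<open>\<mu> = 0\<close>. It is read off the linear combination with coefficient
      1 at \<open>i\<close> and 0 elsewhere.\<close>
    have "integrable M (X (t i))" if "i < n" for i
    proof -
      have "(\<Sum>j<n. (if j = i then 1 else 0) * X (t j) \<omega>) = X (t i) \<omega>" for \<omega>
        using that by (simp add: if_distrib[of "\<lambda>x. x * _"] sum.delta cong: if_cong)
      then obtain \<mu> \<sigma> where "\<sigma> \<ge> 0" "distr M borel (X (t i)) = normal_law \<mu> \<sigma>"
        using mn[unfolded multivariate_normal_def, THEN conjunct2, THEN spec, of "\<lambda>j. if j = i then 1 else 0"]
        by auto
      then have "integrable (distr M borel (X (t i))) (\<lambda>x. x)"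
        using integrable.intros[OF normal_law_mean] by simp
      then show ?thesis
        using that by (subst (asm) integrable_distr_eq) auto
    qed
    then have "expectation f = (\<Sum>i<n. a i * expectation (X (t i)))"
      unfolding f by (subst Bochner_Integration.integral_sum) auto
    then have "expectation f = 0" using e0 by simp
    moreover have "expectation f = (\<integral>x. x \<partial>distr M borel f)"
      by (subst integral_distr) auto
    ultimately have "\<mu> = 0"
      using \<sigma> has_bochner_integral_integral_eq[OF normal_law_mean] by simp
    with \<sigma> show "\<exists>\<sigma>\<ge>0. distr M borel f = normal_law 0 \<sigma>" by auto
    assume "g \<in> V"
    then obtain m :: nat and b s where g: "g = (\<lambda>\<omega>. \<Sum>i<m. b i * X (s i) \<omega>)" and s: "\<forall>i<m. s i \<ge> (0::real)"
      unfolding V_def by blast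
    define a' where "a' i = (if i < n then a i else b (i - n))" for i
    define t' where "t' i = (if i < n then t i else s (i - n))" for i
    have "(\<Sum>i<n + m. a' i * X (t' i) \<omega>) = f \<omega> + g \<omega>" for \<omega>
    proof -
      have "(\<Sum>i<n + m. a' i * X (t' i) \<omega>) = (\<Sum>i<n. a' i * X (t' i) \<omega>) + (\<Sum>i=n..<n+m. a' i * X (t' i) \<omega>)"
        by (simp add: lessThan_atLeast0 sum.atLeastLessThan_concat)
      also have "(\<Sum>i=n..<n+m. a' i * X (t' i) \<omega>) = (\<Sum>i<m. a' (i + n) * X (t' (i + n)) \<omega>)"
        using sum.shift_bounds_nat_ivl[of "\<lambda>i. a' i * X (t' i) \<omega>" 0 n m] by (simp add: lessThan_atLeast0 add.commute)
      finally show ?thesis by (simp add: f g a'_def t'_def)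
    qed
    moreover have "\<forall>i<n + m. t' i \<ge> 0" using s t by (auto simp: t'_def)
    ultimately show "(\<lambda>\<omega>. f \<omega> + g \<omega>) \<in> V"
      using VI[of "n + m" t' a'] by simp
  qed
  moreover have "X t \<in> V" if "t \<ge> 0" for t
    using VI[of 1 "\<lambda>_. t" "\<lambda>_. 1"] that by simp
  ultimately show ?thesis by blast
qed

lemma (in prob_space) brownian_motion_iff:
  "brownian_motion X \<longleftrightarrow>
     (AE \<omega> in M. continuous_on {0..} (\<lambda>t. X t \<omega>)) \<and>
     (\<exists>V. gaussian_space M V \<and> (\<forall>t\<ge>0. X t \<in> V)) \<and>
     (\<forall>s\<ge>0. \<forall>t\<ge>0. expectation (\<lambda>\<omega>. X s \<omega> * X t \<omega>) = min s t)" (is "_ \<longleftrightarrow> ?R")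
proof
  assume *: "brownian_motion X"
  then obtain V where V: "gaussian_space M V" "\<forall>t\<ge>0. X t \<in> V"
    using brownian_motion_gaussian_space by auto
  interpret gaussian_space M V by (rule V)
  have "expectation (\<lambda>\<omega>. X s \<omega> * X t \<omega>) = min s t" if "s \<ge> 0" "t \<ge> 0" for s t
  proof -
    \<comment> \<open>Covariances are prescribed along finite families of times, so \<open>s\<close>
      and \<open>t\<close> become entries 0 and 1 of a family of length 2.\<close>
    let ?t = "\<lambda>i::nat. if i = 0 then s else t"
    have "\<forall>i<2. \<forall>j<2. covariance (X (?t i)) (X (?t j)) = min (?t i) (?t j)"
      using * that unfolding brownian_motion_def
      by (elim conjE, elim allE[of _ 2] allE[of _ ?t]) auto
    from this[rule_format, of 0 1] have "covariance (X s) (X t) = min s t" by simp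
    then show ?thesis
      using that V(2) by (simp add: covariance_def expectation_eq_0)
  qed
  moreover have "AE \<omega> in M. continuous_on {0..} (\<lambda>t. X t \<omega>)"
    using * by (simp add: brownian_motion_def)
  ultimately show ?R using V by blast
next
  assume R: ?R
  then obtain V where V: "gaussian_space M V" "\<forall>t\<ge>0. X t \<in> V" by auto
  interpret gaussian_space M V by (rule V)
  have "multivariate_normal n (\<lambda>i. X (t i))" if "\<forall>i<n. t i \<ge> 0" for n :: nat and t
  proof -
    have "(\<lambda>\<omega>. \<Sum>i<n. a i * X (t i) \<omega>) \<in> V" for a
      using that
    proof (induction n)
      case (Suc n)
      then have "(\<lambda>\<omega>. \<Sum>i<n. a i * X (t i) \<omega>) \<in> V" "(\<lambda>\<omega>. a n * X (t n) \<omega>) \<in> V"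
        using V(2) by (auto intro: scale)
      from add[OF this] show ?case by simp
    qed (simp add: zero)
    then show ?thesis
      using law measurable V(2) that unfolding multivariate_normal_def by blast
  qed
  then show "brownian_motion X"
    using R V(2) by (simp add: brownian_motion_def covariance_def expectation_eq_0 measurable)
qed

section \<open>Independence and equality of laws from covariances\<close>

lemma (in prob_space) indep_var_PiM:
  fixes X :: "'i \<Rightarrow> 'a \<Rightarrow> 'b" and Y :: "'i \<Rightarrow> 'a \<Rightarrow> 'b"
  assumes X: "\<And>i. i \<in> I \<Longrightarrow> X i \<in> measurable M (P i)" and Y: "\<And>j. j \<in> J \<Longrightarrow> Y j \<in> measurable M (Q j)"
    and rect: "\<And>K L A C. finite K \<Longrightarrow> K \<subseteq> I \<Longrightarrow> finite L \<Longrightarrow> L \<subseteq> J \<Longrightarrow>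
      (\<And>i. i \<in> K \<Longrightarrow> A i \<in> sets (P i)) \<Longrightarrow> (\<And>j. j \<in> L \<Longrightarrow> C j \<in> sets (Q j)) \<Longrightarrow>
      prob {\<omega>\<in>space M. (\<forall>i\<in>K. X i \<omega> \<in> A i) \<and> (\<forall>j\<in>L. Y j \<omega> \<in> C j)} =
      prob {\<omega>\<in>space M. \<forall>i\<in>K. X i \<omega> \<in> A i} * prob {\<omega>\<in>space M. \<forall>j\<in>L. Y j \<omega> \<in> C j}"
  shows "indep_var (PiM I P) (\<lambda>\<omega>. \<lambda>i\<in>I. X i \<omega>) (PiM J Q) (\<lambda>\<omega>. \<lambda>j\<in>J. Y j \<omega>)"
proof -
  let ?X = "\<lambda>\<omega>. \<lambda>i\<in>I. X i \<omega>" and ?Y = "\<lambda>\<omega>. \<lambda>j\<in>J. Y j \<omega>"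
  let ?GX = "{?X -` A \<inter> space M |A. A \<in> prod_algebra I P}"
  let ?GY = "{?Y -` A \<inter> space M |A. A \<in> prod_algebra J Q}"
  have rX: "?X \<in> measurable M (PiM I P)" and rY: "?Y \<in> measurable M (PiM J Q)"
    using X Y by (auto intro!: measurable_restrict)
  have sX: "{?X -` A \<inter> space M |A. A \<in> sets (PiM I P)} = sigma_sets (space M) ?GX"
    unfolding sets_PiM using measurable_space[OF rX]
    by (intro sigma_sets_vimage_commute) (auto simp: space_PiM)
  have sY: "{?Y -` A \<inter> space M |A. A \<in> sets (PiM J Q)} = sigma_sets (space M) ?GY"
    unfolding sets_PiM using measurable_space[OF rY]
    by (intro sigma_sets_vimage_commute) (auto simp: space_PiM)
  \<comment> \<open>Preimages of the finite-dimensional cylinders form an intersection-stable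
    generator, so independence on cylinders extends to the generated sigma-algebras.\<close>
  have stable: "Int_stable {f -` A \<inter> space M |A. A \<in> G}" if "Int_stable G" for f :: "'a \<Rightarrow> 'd" and G
  proof (rule Int_stableI)
    fix a b assume "a \<in> {f -` A \<inter> space M |A. A \<in> G}" "b \<in> {f -` A \<inter> space M |A. A \<in> G}"
    then obtain A B where "A \<in> G" "B \<in> G" "a \<inter> b = f -` (A \<inter> B) \<inter> space M" by blast
    with that show "a \<inter> b \<in> {f -` A \<inter> space M |A. A \<in> G}"
      unfolding Int_stable_def by blast
  qed
  \<comment> \<open>Coordinates outside \<open>K\<close> are constrained only to lie in their
    spaces, which holds by measurability.\<close>
  have vimage: "(\<lambda>\<omega>. \<lambda>i\<in>I'. Z i \<omega>) -` prod_emb I' R K (Pi\<^sub>E K A) \<inter> space M =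
      {\<omega>\<in>space M. \<forall>i\<in>K. Z i \<omega> \<in> A i}"
    if "K \<subseteq> I'" "\<And>i. i \<in> I' \<Longrightarrow> Z i \<in> measurable M (R i)"
    for Z :: "'k \<Rightarrow> 'a \<Rightarrow> 'd" and I' K A R
  proof (intro set_eqI)
    fix \<omega>
    have "Z i \<omega> \<in> space (R i)" if "\<omega> \<in> space M" "i \<in> I'" for i
      using that \<open>\<And>i. i \<in> I' \<Longrightarrow> Z i \<in> measurable M (R i)\<close> by (auto dest: measurable_space)
    then show "\<omega> \<in> (\<lambda>\<omega>. \<lambda>i\<in>I'. Z i \<omega>) -` prod_emb I' R K (Pi\<^sub>E K A) \<inter> space M \<longleftrightarrow>
        \<omega> \<in> {\<omega>\<in>space M. \<forall>i\<in>K. Z i \<omega> \<in> A i}"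
      using \<open>K \<subseteq> I'\<close>
      by (auto simp: prod_emb_def restrict_PiE_iff Int_absorb1 split: if_splits)
  qed
  have "indep_set ?GX ?GY"
  proof (rule indep_setI)
    show "?GX \<subseteq> events"
      using rX by (auto intro!: measurable_sets[OF rX] simp: sets_PiM)
    show "?GY \<subseteq> events"
      using rY by (auto intro!: measurable_sets[OF rY] simp: sets_PiM)
    fix a b assume "a \<in> ?GX" "b \<in> ?GY"
    then obtain E F where a: "a = ?X -` E \<inter> space M" "E \<in> prod_algebra I P"
      and b: "b = ?Y -` F \<inter> space M" "F \<in> prod_algebra J Q" by auto
    obtain K A where E: "E = prod_emb I P K (Pi\<^sub>E K A)" "finite K" "K \<subseteq> I" "\<And>i. i \<in> K \<Longrightarrow> A i \<in> sets (P i)"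
      using prod_algebraE[OF a(2)] by metis
    obtain L C where F: "F = prod_emb J Q L (Pi\<^sub>E L C)" "finite L" "L \<subseteq> J" "\<And>i. i \<in> L \<Longrightarrow> C i \<in> sets (Q i)"
      using prod_algebraE[OF b(2)] by metis
    have a': "a = {\<omega>\<in>space M. \<forall>i\<in>K. X i \<omega> \<in> A i}"
      unfolding a E using E(3) X by (intro vimage)
    have b': "b = {\<omega>\<in>space M. \<forall>j\<in>L. Y j \<omega> \<in> C j}"
      unfolding b F using F(3) Y by (intro vimage)
    have "a \<inter> b = {\<omega>\<in>space M. (\<forall>i\<in>K. X i \<omega> \<in> A i) \<and> (\<forall>j\<in>L. Y j \<omega> \<in> C j)}"
      unfolding a' b' by auto
    then show "prob (a \<inter> b) = prob a * prob b"
      unfolding a' b' using rect[of K L A C] E F by simp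
  qed
  then have "indep_set (sigma_sets (space M) ?GX) (sigma_sets (space M) ?GY)"
    by (intro indep_set_sigma_sets stable Int_stable_prod_algebra)
  moreover have "sigma_sets (space M) (sigma_sets (space M) ?GX) = sigma_sets (space M) ?GX"
    "sigma_sets (space M) (sigma_sets (space M) ?GY) = sigma_sets (space M) ?GY"
    by (intro sigma_sets_sigma_sets_eq; blast)+
  ultimately show ?thesis
    unfolding indep_var_eq sX sY using rX rY by simp
qed

text \<open>The independent copies live on the product of \<open>M\<close> with itself,
  \<open>X\<close> reading the first coordinate and \<open>Y\<close> the second. Orthogonality makes
  second moments add, so \<open>f + g\<close> and its decoupled version have the same cosine
  integrals; rectangle probabilities then factor as in the product measure.\<close>

lemma (in gaussian_space) uncorrelated_imp_indep:
  fixes X :: "'i \<Rightarrow> 'a \<Rightarrow> real" and Y :: "'i \<Rightarrow> 'a \<Rightarrow> real"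
  assumes X: "\<And>i. i \<in> I \<Longrightarrow> X i \<in> V" and Y: "\<And>j. j \<in> J \<Longrightarrow> Y j \<in> V"
    and ortho: "\<And>i j. i \<in> I \<Longrightarrow> j \<in> J \<Longrightarrow> expectation (\<lambda>\<omega>. X i \<omega> * Y j \<omega>) = 0"
  shows "indep_var (PiM I (\<lambda>_. borel)) (\<lambda>\<omega>. \<lambda>i\<in>I. X i \<omega>) (PiM J (\<lambda>_. borel)) (\<lambda>\<omega>. \<lambda>j\<in>J. Y j \<omega>)"
proof (rule indep_var_PiM)
  show "X i \<in> borel_measurable M" if "i \<in> I" for i using measurable X that by auto
  show "Y j \<in> borel_measurable M" if "j \<in> J" for j using measurable Y that by auto
  \<comment> \<open>\<open>F\<close> is the orthogonal complement of the family \<open>Y\<close> in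
    \<open>V\<close>, and \<open>G\<close> that of \<open>F\<close>. Thus \<open>X\<close> lies in
    \<open>F\<close>, \<open>Y\<close> in the double complement \<open>G\<close>, and all of
    \<open>F\<close> is orthogonal to all of \<open>G\<close>.\<close>
  define F where "F = {f\<in>V. \<forall>j\<in>J. expectation (\<lambda>\<omega>. f \<omega> * Y j \<omega>) = 0}"
  define G where "G = {g\<in>V. \<forall>f\<in>F. expectation (\<lambda>\<omega>. g \<omega> * f \<omega>) = 0}"
  have F_add: "(\<lambda>\<omega>. f \<omega> + f' \<omega>) \<in> F" if "f \<in> F" "f' \<in> F" for f f'
    using that Y by (auto simp: F_def add expectation_add_mult)
  have G_add: "(\<lambda>\<omega>. f \<omega> + f' \<omega>) \<in> G" if "f \<in> G" "f' \<in> G" for f f'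
    using that by (auto simp: G_def add F_def expectation_add_mult)
  have F_scale: "(\<lambda>\<omega>. c * f \<omega>) \<in> F" if "f \<in> F" for f c
    using that by (auto simp: F_def scale mult.assoc)
  have G_scale: "(\<lambda>\<omega>. c * f \<omega>) \<in> G" if "f \<in> G" for f c
    using that by (auto simp: G_def scale mult.assoc)
  have F_zero: "(\<lambda>_. 0) \<in> F" and G_zero: "(\<lambda>_. 0) \<in> G"
    using zero by (auto simp: F_def G_def)
  have XF: "X i \<in> F" if "i \<in> I" for i
    using X that ortho by (auto simp: F_def)
  have YG: "Y j \<in> G" if "j \<in> J" for j
    using Y that by (auto simp: F_def G_def mult.commute)
  let ?N = "M \<Otimes>\<^sub>M M"
  interpret P: pair_prob_space M M ..
  define W where "W = {(\<lambda>\<omega>. f \<omega> + g \<omega>, \<lambda>p. f (fst p) + g (snd p)) | f g. f \<in> F \<and> g \<in> G}"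
  have WI: "(\<lambda>\<omega>. f \<omega> + g \<omega>, \<lambda>p. f (fst p) + g (snd p)) \<in> W" if "f \<in> F" "g \<in> G" for f g
    using that unfolding W_def by blast
  have WE: "\<exists>f g. u = (\<lambda>\<omega>. f \<omega> + g \<omega>) \<and> v = (\<lambda>p. f (fst p) + g (snd p)) \<and> f \<in> F \<and> g \<in> G"
    if "(u, v) \<in> W" for u v
    using that unfolding W_def by blast
  fix K L A C
  assume K: "finite K" "K \<subseteq> I" "\<And>i. i \<in> K \<Longrightarrow> A i \<in> sets (borel :: real measure)"
    and L: "finite L" "L \<subseteq> J" "\<And>j. j \<in> L \<Longrightarrow> C j \<in> sets (borel :: real measure)"
  \<comment> \<open>The disjoint sum of the index sets merges both families into one, as
    \<open>joint_law_eqI\<close> expects.\<close>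
  let ?X = "case_sum X Y" and ?Y = "case_sum (\<lambda>i p. X i (fst p)) (\<lambda>j p. Y j (snd p))"
  have ball_Plus: "(\<forall>k\<in>K <+> L. Q k) \<longleftrightarrow> (\<forall>i\<in>K. Q (Inl i)) \<and> (\<forall>j\<in>L. Q (Inr j))" for Q
    by auto
  have "prob {\<omega>\<in>space M. \<forall>k\<in>K <+> L. ?X k \<omega> \<in> case_sum A C k} =
    measure ?N {p\<in>space ?N. \<forall>k\<in>K <+> L. ?Y k p \<in> case_sum A C k}"
  proof (rule joint_law_eqI)
    show "prob_space M" "prob_space ?N" by unfold_locales
    show "finite (K <+> L)" using K L by simp
    show "case_sum A C k \<in> sets borel" if "k \<in> K <+> L" for k
      using K L that by auto
    show "(?X k, ?Y k) \<in> W" if "k \<in> K <+> L" for k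
      using that WI[OF XF G_zero] WI[OF F_zero YG] K(2) L(2) by auto
  next
    fix u v u' v' assume uv: "(u, v) \<in> W" "(u', v') \<in> W"
    obtain f g where *: "f \<in> F" "g \<in> G"
      "u = (\<lambda>\<omega>. f \<omega> + g \<omega>)" "v = (\<lambda>p. f (fst p) + g (snd p))"
      using WE[OF uv(1)] by blast
    obtain f' g' where **: "f' \<in> F" "g' \<in> G"
      "u' = (\<lambda>\<omega>. f' \<omega> + g' \<omega>)" "v' = (\<lambda>p. f' (fst p) + g' (snd p))"
      using WE[OF uv(2)] by blast
    have "(\<lambda>x. u x + u' x, \<lambda>y. v y + v' y) =
        (\<lambda>\<omega>. (f \<omega> + f' \<omega>) + (g \<omega> + g' \<omega>), \<lambda>p. (f (fst p) + f' (fst p)) + (g (snd p) + g' (snd p)))"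
      unfolding * ** by (simp add: fun_eq_iff)
    then show "(\<lambda>x. u x + u' x, \<lambda>y. v y + v' y) \<in> W"
      using WI[OF F_add[OF *(1) **(1)] G_add[OF *(2) **(2)]] by simp
  next
    fix u v c assume uv: "(u, v) \<in> W"
    obtain f g where *: "f \<in> F" "g \<in> G"
      "u = (\<lambda>\<omega>. f \<omega> + g \<omega>)" "v = (\<lambda>p. f (fst p) + g (snd p))"
      using WE[OF uv] by blast
    show "(\<lambda>x. c * u x, \<lambda>y. c * v y) \<in> W"
      using WI[OF F_scale[OF *(1)] G_scale[OF *(2)], of c c] unfolding * by (simp add: distrib_left)
  next
    fix u v assume W: "(u, v) \<in> W"
    obtain f g where *: "f \<in> F" "g \<in> G"
      and uv: "u = (\<lambda>\<omega>. f \<omega> + g \<omega>)" "v = (\<lambda>p. f (fst p) + g (snd p))"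
      using WE[OF W] by blast
    then have V: "f \<in> V" "g \<in> V" and fg: "expectation (\<lambda>\<omega>. f \<omega> * g \<omega>) = 0"
      by (auto simp: F_def G_def mult.commute)
    have [measurable]: "f \<in> borel_measurable M" "g \<in> borel_measurable M"
      using V measurable by auto
    show "u \<in> borel_measurable M \<and> v \<in> borel_measurable ?N"
      unfolding uv by measurable
    fix \<theta>
    \<comment> \<open>Fubini: with the first coordinate fixed, \<open>f \<omega> + \<theta>\<close>
      is merely a phase for \<open>g\<close>, and \<open>expectation_cos\<close> applies to
      \<open>g\<close> and then to \<open>f\<close>.\<close>
    have "(\<integral>p. cos (v p + \<theta>) \<partial>?N) = (\<integral>\<omega>. \<integral>\<omega>'. cos (v (\<omega>, \<omega>') + \<theta>) \<partial>M \<partial>M)"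
      unfolding uv by (intro P.integral_fst'[symmetric] P.P.integrable_const_bound[where B = 1]) auto
    also have "\<dots> = (\<integral>\<omega>. cos (f \<omega> + \<theta>) * exp (- expectation (\<lambda>\<omega>. (g \<omega>)\<^sup>2) / 2) \<partial>M)"
    proof (intro Bochner_Integration.integral_cong refl)
      fix \<omega>
      have "(\<integral>\<omega>'. cos (v (\<omega>, \<omega>') + \<theta>) \<partial>M) = (\<integral>\<omega>'. cos (g \<omega>' + (f \<omega> + \<theta>)) \<partial>M)"
        by (simp add: uv ac_simps)
      then show "(\<integral>\<omega>'. cos (v (\<omega>, \<omega>') + \<theta>) \<partial>M) =
          cos (f \<omega> + \<theta>) * exp (- expectation (\<lambda>\<omega>. (g \<omega>)\<^sup>2) / 2)"
        using expectation_cos[OF V(2)] by simp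
    qed
    also have "\<dots> = cos \<theta> * exp (- (expectation (\<lambda>\<omega>. (f \<omega>)\<^sup>2) + expectation (\<lambda>\<omega>. (g \<omega>)\<^sup>2)) / 2)"
    proof -
      have "exp (- (a + b) / 2) = exp (- a / 2) * exp (- b / 2)" for a b :: real
        by (simp add: exp_add[symmetric] field_simps)
      then show ?thesis
        using expectation_cos[OF V(1)] by simp
    qed
    \<comment> \<open>The cross term in the second moment of \<open>f + g\<close> vanishes by
      orthogonality.\<close>
    also have "\<dots> = (\<integral>\<omega>. cos (u \<omega> + \<theta>) \<partial>M)"
      unfolding uv using expectation_cos[OF add[OF V]] by (simp add: expectation_add_square V fg)
    finally show "(\<integral>\<omega>. cos (u \<omega> + \<theta>) \<partial>M) = (\<integral>p. cos (v p + \<theta>) \<partial>?N)" ..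
  qed
  also have "{\<omega>\<in>space M. \<forall>k\<in>K <+> L. ?X k \<omega> \<in> case_sum A C k} =
    {\<omega>\<in>space M. (\<forall>i\<in>K. X i \<omega> \<in> A i) \<and> (\<forall>j\<in>L. Y j \<omega> \<in> C j)}"
    by (simp add: ball_Plus)
  also have "{p\<in>space ?N. \<forall>k\<in>K <+> L. ?Y k p \<in> case_sum A C k} =
    {\<omega>\<in>space M. \<forall>i\<in>K. X i \<omega> \<in> A i} \<times> {\<omega>\<in>space M. \<forall>j\<in>L. Y j \<omega> \<in> C j}"
    by (auto simp: space_pair_measure ball_Plus)
  also have "measure ?N \<dots> =
    prob {\<omega>\<in>space M. \<forall>i\<in>K. X i \<omega> \<in> A i} * prob {\<omega>\<in>space M. \<forall>j\<in>L. Y j \<omega> \<in> C j}"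
  proof -
    have "{\<omega>\<in>space M. \<forall>i\<in>K. X i \<omega> \<in> A i} \<in> events"
    proof (rule sets.sets_Collect_finite_All)
      fix i assume "i \<in> K"
      then have [measurable]: "X i \<in> borel_measurable M" "A i \<in> sets borel"
        using K X measurable by auto
      show "{\<omega>\<in>space M. X i \<omega> \<in> A i} \<in> events" by measurable
    qed (rule K)
    moreover have "{\<omega>\<in>space M. \<forall>j\<in>L. Y j \<omega> \<in> C j} \<in> events"
    proof (rule sets.sets_Collect_finite_All)
      fix j assume "j \<in> L"
      then have [measurable]: "Y j \<in> borel_measurable M" "C j \<in> sets borel"
        using L Y measurable by auto
      show "{\<omega>\<in>space M. Y j \<omega> \<in> C j} \<in> events" by measurable
    qed (rule L)
    ultimately show ?thesis
      by (simp add: measure_def emeasure_pair_measure_Times enn2real_mult)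
  qed
  finally show "prob {\<omega>\<in>space M. (\<forall>i\<in>K. X i \<omega> \<in> A i) \<and> (\<forall>j\<in>L. Y j \<omega> \<in> C j)} =
    prob {\<omega>\<in>space M. \<forall>i\<in>K. X i \<omega> \<in> A i} * prob {\<omega>\<in>space M. \<forall>j\<in>L. Y j \<omega> \<in> C j}" .
qed

text \<open>Equal covariances make the correspondence from \<open>X i\<close> to \<open>Y i\<close>
  isometric on linear combinations, so paired combinations have equal cosine integrals. The index
  set may be infinite because finite cylinders determine a finite measure on the product.\<close>

lemma gaussian_process_law_eqI:
  fixes X :: "'i \<Rightarrow> 'a \<Rightarrow> real" and Y :: "'i \<Rightarrow> 'b \<Rightarrow> real"
  assumes "gaussian_space M V" "gaussian_space N W"
    and X: "\<And>i. i \<in> I \<Longrightarrow> X i \<in> V" and Y: "\<And>i. i \<in> I \<Longrightarrow> Y i \<in> W"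
    and cov: "\<And>i j. i \<in> I \<Longrightarrow> j \<in> I \<Longrightarrow> (\<integral>x. X i x * X j x \<partial>M) = (\<integral>y. Y i y * Y j y \<partial>N)"
  shows "distr M (PiM I (\<lambda>_. borel)) (\<lambda>x. \<lambda>i\<in>I. X i x) = distr N (PiM I (\<lambda>_. borel)) (\<lambda>y. \<lambda>i\<in>I. Y i y)"
proof -
  interpret M: gaussian_space M V by fact
  interpret N: gaussian_space N W by fact
  define P where "P = {(f, g). f \<in> V \<and> g \<in> W \<and>
    (\<forall>i\<in>I. M.expectation (\<lambda>x. f x * X i x) = N.expectation (\<lambda>y. g y * Y i y))}"
  \<comment> \<open>Intersecting \<open>P\<close> with its own orthogonality class gives a space of pairs that is closed under
    linear combinations, contains the pairs \<open>(X i, Y i)\<close>, and whose two components have equal norm.\<close>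
  define R where "R = {(f, g) \<in> P. \<forall>f' g'. (f', g') \<in> P \<longrightarrow> M.expectation (\<lambda>x. f x * f' x) = N.expectation (\<lambda>y. g y * g' y)}"
  have P_add: "(\<lambda>x. f x + f' x, \<lambda>y. g y + g' y) \<in> P" if "(f, g) \<in> P" "(f', g') \<in> P" for f g f' g'
    using that X Y by (auto simp: P_def M.add N.add M.expectation_add_mult N.expectation_add_mult)
  have P_scale: "(\<lambda>x. c * f x, \<lambda>y. c * g y) \<in> P" if "(f, g) \<in> P" for f g c
    using that by (auto simp: P_def M.scale N.scale mult.assoc)
  have PV: "f \<in> V" "g \<in> W" if "(f, g) \<in> P" for f g
    using that by (auto simp: P_def)
  have XP: "(X i, Y i) \<in> P" if "i \<in> I" for i
    using that X Y cov by (auto simp: P_def)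
  have XR: "(X i, Y i) \<in> R" if "i \<in> I" for i
    using that XP by (auto simp: R_def) (auto simp: P_def mult.commute)
  let ?X = "\<lambda>x. \<lambda>i\<in>I. X i x" and ?Y = "\<lambda>y. \<lambda>i\<in>I. Y i y"
  have X_meas: "?X \<in> measurable M (PiM I (\<lambda>_. borel))"
    using X M.measurable by (auto intro!: measurable_restrict)
  have Y_meas: "?Y \<in> measurable N (PiM I (\<lambda>_. borel))"
    using Y N.measurable by (auto intro!: measurable_restrict)
  show ?thesis
  proof (rule measure_eqI_PiM_infinite)
    show "finite_measure (distr M (PiM I (\<lambda>_. borel)) ?X)"
      by (rule M.finite_measure_distr[OF X_meas])
    fix A :: "'i \<Rightarrow> real set" and J
    assume J: "finite J" "J \<subseteq> I" and A: "\<And>i. i \<in> J \<Longrightarrow> A i \<in> sets borel"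
    have "M.prob {x\<in>space M. \<forall>j\<in>J. X j x \<in> A j} = N.prob {y\<in>space N. \<forall>j\<in>J. Y j y \<in> A j}"
    proof (rule joint_law_eqI)
      show "prob_space M" "prob_space N" by unfold_locales
      show "(X j, Y j) \<in> R" if "j \<in> J" for j
        using that J XR by auto
    next
      fix f g f' g' assume "(f, g) \<in> R" "(f', g') \<in> R"
      then show "(\<lambda>x. f x + f' x, \<lambda>y. g y + g' y) \<in> R"
        using P_add by (auto simp: R_def M.expectation_add_mult N.expectation_add_mult PV)
    next
      fix f g c assume "(f, g) \<in> R"
      then show "(\<lambda>x. c * f x, \<lambda>y. c * g y) \<in> R"
        using P_scale by (auto simp: R_def mult.assoc)
    next
      fix f g assume *: "(f, g) \<in> R"
      then have V: "f \<in> V" "g \<in> W" by (auto simp: R_def PV)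
      then show "f \<in> borel_measurable M \<and> g \<in> borel_measurable N"
        using M.measurable N.measurable by auto
      \<comment> \<open>A pair in \<open>R\<close> also lies in \<open>P\<close>, so the defining
        condition of \<open>R\<close> may be tested on the pair itself.\<close>
      have "M.expectation (\<lambda>x. (f x)\<^sup>2) = N.expectation (\<lambda>y. (g y)\<^sup>2)"
        using * by (auto simp: R_def power2_eq_square)
      then show "M.expectation (\<lambda>x. cos (f x + \<theta>)) = N.expectation (\<lambda>y. cos (g y + \<theta>))" for \<theta>
        using V by (simp add: M.expectation_cos N.expectation_cos)
    qed (use J A in auto)
    moreover have "?X -` prod_emb I (\<lambda>_. borel) J (Pi\<^sub>E J A) \<inter> space M = {x\<in>space M. \<forall>j\<in>J. X j x \<in> A j}"
      "?Y -` prod_emb I (\<lambda>_. borel) J (Pi\<^sub>E J A) \<inter> space N = {y\<in>space N. \<forall>j\<in>J. Y j y \<in> A j}"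
      using J(2) by (auto simp: prod_emb_def restrict_PiE_iff Int_absorb1 split: if_splits)
    ultimately show "emeasure (distr M (PiM I (\<lambda>_. borel)) ?X) (prod_emb I (\<lambda>_. borel) J (Pi\<^sub>E J A)) =
      emeasure (distr N (PiM I (\<lambda>_. borel)) ?Y) (prod_emb I (\<lambda>_. borel) J (Pi\<^sub>E J A))"
      using J A
      by (simp add: emeasure_distr X_meas Y_meas sets_PiM_I_finite M.emeasure_eq_measure N.emeasure_eq_measure)
  qed simp_all
qed

section \<open>Path properties\<close>

text \<open>By continuity the set where \<open>\<bar>x t\<bar>\<close> exceeds a given bound is open
  in the open half-line, so a violation at a real time forces one at a nearby rational time. All
  quantifiers on the right range over countable sets, which makes the condition measurable.\<close>

lemma tendsto_0_at_right_iff_rat: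
  fixes x :: "real \<Rightarrow> real"
  assumes "continuous_on {0<..} x"
  shows "(x \<longlongrightarrow> 0) (at_right 0) \<longleftrightarrow>
    (\<forall>n::nat. \<exists>m::nat. \<forall>q\<in>\<rat> \<inter> {0<..}. q < inverse (Suc m) \<longrightarrow> \<bar>x q\<bar> \<le> inverse (Suc n))"
proof
  assume lim: "(x \<longlongrightarrow> 0) (at_right 0)"
  show "\<forall>n::nat. \<exists>m::nat. \<forall>q\<in>\<rat> \<inter> {0<..}. q < inverse (Suc m) \<longrightarrow> \<bar>x q\<bar> \<le> inverse (Suc n)"
  proof
    fix n :: nat
    have "eventually (\<lambda>t. dist (x t) 0 < inverse (Suc n)) (at_right 0)"
      by (rule tendstoD[OF lim]) simp
    then obtain b where b: "b > 0" "\<And>t. 0 < t \<Longrightarrow> t < b \<Longrightarrow> \<bar>x t\<bar> < inverse (Suc n)"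
      by (auto simp: eventually_at_right_field)
    obtain m where "inverse (real (Suc m)) < b"
      using reals_Archimedean[OF b(1)] by auto
    then show "\<exists>m::nat. \<forall>q\<in>\<rat> \<inter> {0<..}. q < inverse (Suc m) \<longrightarrow> \<bar>x q\<bar> \<le> inverse (Suc n)"
      using b(2) by (intro exI[of _ m]) (auto intro!: less_imp_le)
  qed
next
  assume *: "\<forall>n::nat. \<exists>m::nat. \<forall>q\<in>\<rat> \<inter> {0<..}. q < inverse (Suc m) \<longrightarrow> \<bar>x q\<bar> \<le> inverse (Suc n)"
  show "(x \<longlongrightarrow> 0) (at_right 0)"
  proof (rule tendstoI)
    fix e :: real assume "e > 0"
    then obtain n where n: "inverse (real (Suc n)) < e"
      using reals_Archimedean by auto
    obtain m :: nat where m: "\<forall>q\<in>\<rat> \<inter> {0<..}. q < inverse (Suc m) \<longrightarrow> \<bar>x q\<bar> \<le> inverse (Suc n)"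
      using * by blast
    have "\<bar>x t\<bar> \<le> inverse (Suc n)" if t: "0 < t" "t < inverse (Suc m)" for t
    proof (rule ccontr)
      assume "\<not> \<bar>x t\<bar> \<le> inverse (Suc n)"
      let ?S = "{0<..<inverse (real (Suc m))}"
      \<comment> \<open>Intersecting with \<open>?S\<close> keeps the rational found below positive
        and smaller than \<open>inverse (Suc m)\<close>, so that \<open>m\<close> applies to
        it.\<close>
      let ?U = "?S \<inter> (\<lambda>t. \<bar>x t\<bar>) -` {inverse (real (Suc n))<..}"
      have "open ?U"
        by (intro continuous_open_preimage continuous_intros continuous_on_subset[OF assms]) auto
      moreover have "t \<in> ?U"
        using t \<open>\<not> \<bar>x t\<bar> \<le> inverse (Suc n)\<close> by auto
      ultimately obtain d where d: "d > 0" "ball t d \<subseteq> ?U"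
        by (meson openE)
      obtain q where "q \<in> \<rat>" "t < q" "q < t + d"
        using Rats_dense_in_real[of t "t + d"] d(1) by auto
      then have "q \<in> ?U" using d by (intro subsetD[OF d(2)]) (auto simp: dist_real_def)
      then show False using bspec[OF m, of q] \<open>q \<in> \<rat>\<close> by auto
    qed
    then show "eventually (\<lambda>t. dist (x t) 0 < e) (at_right 0)"
      using n unfolding eventually_at_right_field
      by (intro exI[of _ "inverse (real (Suc m))"]) force
  qed
qed

text \<open>The value at time 0 is not prescribed; its second moment is \<open>min 0 0 = 0\<close>,
  so it vanishes almost surely, and path continuity gives the limit.\<close>

lemma (in prob_space) brownian_motion_AE_tendsto_0:
  assumes "brownian_motion B"
  shows "AE \<omega> in M. ((\<lambda>t. B t \<omega>) \<longlongrightarrow> 0) (at_right 0)"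
proof -
  obtain V where V: "gaussian_space M V" "\<forall>t\<ge>0. B t \<in> V"
    and cont: "AE \<omega> in M. continuous_on {0..} (\<lambda>t. B t \<omega>)"
    and cov: "\<forall>s\<ge>0. \<forall>t\<ge>0. expectation (\<lambda>\<omega>. B s \<omega> * B t \<omega>) = min s t"
    using assms unfolding brownian_motion_iff by blast
  interpret gaussian_space M V by fact
  have "expectation (\<lambda>\<omega>. (B 0 \<omega>)\<^sup>2) = 0"
    using cov by (simp add: power2_eq_square)
  then have "AE \<omega> in M. (B 0 \<omega>)\<^sup>2 = 0"
    using integral_nonneg_eq_0_iff_AE[OF integrable_square] V(2) by auto
  with cont show ?thesis
  proof eventually_elim
    case (elim \<omega>)
    have "((\<lambda>t. B t \<omega>) \<longlongrightarrow> B 0 \<omega>) (at 0 within {0..})"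
      using elim(1) by (auto simp: continuous_on_def)
    then show ?case using elim by (simp add: at_within_Ici_at_right)
  qed
qed

text \<open>The limit at \<open>0\<close> of a path that is continuous on \<open>{0<..}\<close> is determined by its values at
  countably many times, so it can be transferred between processes with the same law.\<close>

lemma (in prob_space) AE_tendsto_0_transfer:
  fixes X Y :: "real \<Rightarrow> 'a \<Rightarrow> real"
  assumes V: "gaussian_space M V"
    and X: "\<And>t. t > 0 \<Longrightarrow> X t \<in> V" and Y: "\<And>t. t > 0 \<Longrightarrow> Y t \<in> V"
    and cov: "\<And>s t. s > 0 \<Longrightarrow> t > 0 \<Longrightarrow> expectation (\<lambda>\<omega>. X s \<omega> * X t \<omega>) = expectation (\<lambda>\<omega>. Y s \<omega> * Y t \<omega>)"
    and cX: "AE \<omega> in M. continuous_on {0<..} (\<lambda>t. X t \<omega>)"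
    and cY: "AE \<omega> in M. continuous_on {0<..} (\<lambda>t. Y t \<omega>)"
    and lim: "AE \<omega> in M. ((\<lambda>t. X t \<omega>) \<longlongrightarrow> 0) (at_right 0)"
  shows "AE \<omega> in M. ((\<lambda>t. Y t \<omega>) \<longlongrightarrow> 0) (at_right 0)"
proof -
  interpret gaussian_space M V by fact
  define D :: "real set" where "D = \<rat> \<inter> {0<..}"
  \<comment> \<open>Since \<open>G\<close> reads a path only on the countable set \<open>D\<close>,
    it is a measurable predicate on the product space over \<open>D\<close>, and its probability
    depends only on the law there.\<close>
  define G where "G x \<longleftrightarrow> (\<forall>n::nat. \<exists>m::nat. \<forall>q\<in>D. q < inverse (Suc m) \<longrightarrow> \<bar>x q\<bar> \<le> inverse (Suc n))"
    for x :: "real \<Rightarrow> real"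
  have [simp]: "countable D" unfolding D_def using countable_rat by blast
  let ?P = "PiM D (\<lambda>_. borel :: real measure)"
  have [measurable]: "Measurable.pred ?P G"
    unfolding G_def by measurable
  have eq: "distr M ?P (\<lambda>\<omega>. \<lambda>t\<in>D. X t \<omega>) = distr M ?P (\<lambda>\<omega>. \<lambda>t\<in>D. Y t \<omega>)"
    using X Y cov by (intro gaussian_process_law_eqI[OF V V]) (auto simp: D_def)
  have mX: "(\<lambda>\<omega>. \<lambda>t\<in>D. X t \<omega>) \<in> measurable M ?P" and mY: "(\<lambda>\<omega>. \<lambda>t\<in>D. Y t \<omega>) \<in> measurable M ?P"
    using X Y measurable by (auto intro!: measurable_restrict simp: D_def)
  have G_restrict: "G (\<lambda>t\<in>D. x t) \<longleftrightarrow> G x" for x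
    by (simp add: G_def)
  have "AE \<omega> in M. G (\<lambda>t. X t \<omega>)"
    using cX lim
  proof eventually_elim
    case (elim \<omega>)
    then show ?case
      using tendsto_0_at_right_iff_rat[OF elim(1)] by (simp add: G_def D_def)
  qed
  then have "AE x in distr M ?P (\<lambda>\<omega>. \<lambda>t\<in>D. X t \<omega>). G x"
    using mX by (subst AE_distr_iff) (auto simp: G_restrict)
  then have "AE \<omega> in M. G (\<lambda>t. Y t \<omega>)"
    unfolding eq using mY by (subst (asm) AE_distr_iff) (auto simp: G_restrict)
  with cY show ?thesis
  proof eventually_elim
    case (elim \<omega>)
    then show ?case
      using tendsto_0_at_right_iff_rat[OF elim(1)] by (simp add: G_def D_def)
  qed
qed

section \<open>Transformations of Brownian motion\<close>

lemma (in prob_space) brownian_motion_time_inversion: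
  fixes B :: "real \<Rightarrow> 'a \<Rightarrow> real"
  defines "X \<equiv> \<lambda>t \<omega>. if t = 0 then 0 else t * B (1 / t) \<omega>"
  assumes "brownian_motion B"
  shows "brownian_motion X" and "AE \<omega> in M. ((\<lambda>t. B t \<omega> / t) \<longlongrightarrow> 0) at_top"
proof -
  obtain V where V: "gaussian_space M V" "\<forall>t\<ge>0. B t \<in> V"
    and cont: "AE \<omega> in M. continuous_on {0..} (\<lambda>t. B t \<omega>)"
    and cov: "\<And>s t. s \<ge> 0 \<Longrightarrow> t \<ge> 0 \<Longrightarrow> expectation (\<lambda>\<omega>. B s \<omega> * B t \<omega>) = min s t"
    using assms(2) unfolding brownian_motion_iff by blast
  interpret gaussian_space M V by fact
  have XV: "X t \<in> V" if "t \<ge> 0" for t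
    using that V(2) zero scale[of "B (1 / t)" t] by (cases "t = 0") (simp_all add: X_def)
  have cov_X: "expectation (\<lambda>\<omega>. X s \<omega> * X t \<omega>) = min s t" if "s \<ge> 0" "t \<ge> 0" for s t
  proof (cases "s = 0 \<or> t = 0")
    case True
    then show ?thesis using that by (auto simp: X_def)
  next
    case False
    then have st: "s > 0" "t > 0" using that by auto
    have "expectation (\<lambda>\<omega>. X s \<omega> * X t \<omega>) = expectation (\<lambda>\<omega>. (s * t) * (B (1 / s) \<omega> * B (1 / t) \<omega>))"
      using False by (intro Bochner_Integration.integral_cong refl) (simp add: X_def)
    also have "\<dots> = s * t * min (1 / s) (1 / t)"
      using cov[of "1 / s" "1 / t"] st by simp
    \<comment> \<open>The smaller reciprocal belongs to the larger time, which it cancels from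
      \<open>s * t\<close>.\<close>
    also have "\<dots> = min s t"
      using st by (auto simp: min_def field_simps)
    finally show ?thesis .
  qed
  have cont_pos: "AE \<omega> in M. continuous_on {0<..} (\<lambda>t. X t \<omega>)"
    using cont
  proof eventually_elim
    case (elim \<omega>)
    have "continuous_on {0<..} (\<lambda>t. t * B (1 / t) \<omega>)"
      by (intro continuous_intros continuous_on_compose2[OF elim]) auto
    then show ?case
      by (rule continuous_on_cong[THEN iffD1, rotated 2]) (auto simp: X_def)
  qed
  \<comment> \<open>\<open>X\<close> and \<open>B\<close> lie in the same \<open>V\<close> with the
    same covariances, and both are almost surely continuous at positive times, so the limit of
    \<open>B\<close> at 0 passes to \<open>X\<close>.\<close>
  have lim: "AE \<omega> in M. ((\<lambda>t. X t \<omega>) \<longlongrightarrow> 0) (at_right 0)"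
  proof (rule AE_tendsto_0_transfer[OF V(1), where X = B])
    show "AE \<omega> in M. continuous_on {0<..} (\<lambda>t. B t \<omega>)"
      using cont by eventually_elim (auto intro: continuous_on_subset)
  qed (use V(2) XV cov cov_X cont_pos brownian_motion_AE_tendsto_0[OF assms(2)] in auto)
  have "AE \<omega> in M. continuous_on {0..} (\<lambda>t. X t \<omega>)"
    using cont_pos lim
  proof eventually_elim
    case (elim \<omega>)
    show ?case
      unfolding continuous_on_def
    proof
      fix t :: real assume "t \<in> {0..}"
      show "((\<lambda>t. X t \<omega>) \<longlongrightarrow> X t \<omega>) (at t within {0..})"
      proof (cases "t = 0")
        case True
        then show ?thesis using elim(2) by (simp add: at_within_Ici_at_right X_def)
      next
        case False
        with \<open>t \<in> {0..}\<close> have "t > 0" by simp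
        then have "isCont (\<lambda>t. X t \<omega>) t"
          using elim(1) by (simp add: continuous_on_eq_continuous_at)
        then show ?thesis
          unfolding isCont_def by (rule tendsto_within_subset) simp
      qed
    qed
  qed
  then show "brownian_motion X"
    unfolding brownian_motion_iff using V(1) XV cov_X by blast
  show "AE \<omega> in M. ((\<lambda>t. B t \<omega> / t) \<longlongrightarrow> 0) at_top"
    using lim
  proof eventually_elim
    case (elim \<omega>)
    \<comment> \<open>For positive \<open>t\<close>, \<open>B t / t\<close> is \<open>X\<close> at
      time \<open>1 / t\<close>, so growth at infinity becomes behaviour at 0.\<close>
    have "((\<lambda>t. X (inverse t) \<omega>) \<longlongrightarrow> 0) at_top"
      by (rule filterlim_compose[OF elim filterlim_inverse_at_right_top])
    moreover have "eventually (\<lambda>t. X (inverse t) \<omega> = B t \<omega> / t) at_top"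
      using eventually_gt_at_top[of 0] by eventually_elim (simp add: X_def field_simps)
    ultimately show ?case
      by (rule Lim_transform_eventually)
  qed
qed

lemma (in prob_space) brownian_motion_scaling:
  assumes "brownian_motion B" "c > 0"
  shows "brownian_motion (\<lambda>t \<omega>. B (c * t) \<omega> / sqrt c)"
proof -
  obtain V where V: "gaussian_space M V" "\<forall>t\<ge>0. B t \<in> V"
    and cont: "AE \<omega> in M. continuous_on {0..} (\<lambda>t. B t \<omega>)"
    and cov: "\<And>s t. s \<ge> 0 \<Longrightarrow> t \<ge> 0 \<Longrightarrow> expectation (\<lambda>\<omega>. B s \<omega> * B t \<omega>) = min s t"
    using assms(1) unfolding brownian_motion_iff by blast
  interpret gaussian_space M V by fact
  have "(\<lambda>\<omega>. B (c * t) \<omega> / sqrt c) \<in> V" if "t \<ge> 0" for t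
    using that scale[of "B (c * t)" "1 / sqrt c"] V(2) assms(2) by simp
  moreover have "AE \<omega> in M. continuous_on {0..} (\<lambda>t. B (c * t) \<omega> / sqrt c)"
    using cont
  proof eventually_elim
    case (elim \<omega>)
    show ?case
      using assms(2) by (intro continuous_intros continuous_on_compose2[OF elim]) auto
  qed
  moreover have "expectation (\<lambda>\<omega>. B (c * s) \<omega> / sqrt c * (B (c * t) \<omega> / sqrt c)) = min s t"
    if "s \<ge> 0" "t \<ge> 0" for s t
    using that cov[of "c * s" "c * t"] assms(2) by (auto simp: min_def)
  ultimately show ?thesis
    unfolding brownian_motion_iff using V(1) by blast
qed

lemma (in prob_space) brownian_motion_weak_markov:
  assumes "brownian_motion B" "t0 \<ge> 0"
  shows "brownian_motion (\<lambda>t \<omega>. B (t0 + t) \<omega> - B t0 \<omega>)"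
    and "indep_processes {0..} (\<lambda>t \<omega>. B (t0 + t) \<omega> - B t0 \<omega>) {0..t0} B"
proof -
  obtain V where V: "gaussian_space M V" "\<forall>t\<ge>0. B t \<in> V"
    and cont: "AE \<omega> in M. continuous_on {0..} (\<lambda>t. B t \<omega>)"
    and cov: "\<And>s t. s \<ge> 0 \<Longrightarrow> t \<ge> 0 \<Longrightarrow> expectation (\<lambda>\<omega>. B s \<omega> * B t \<omega>) = min s t"
    using assms(1) unfolding brownian_motion_iff by blast
  interpret gaussian_space M V by fact
  have inV: "(\<lambda>\<omega>. B (t0 + t) \<omega> - B t0 \<omega>) \<in> V" if "t \<ge> 0" for t
    using that V(2) assms(2) by (intro minus) auto
  \<comment> \<open>One formula serves both claims: for \<open>t \<le> t0\<close> both minima equal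
    \<open>t\<close>, giving orthogonality to the past, while at time \<open>t0 + t\<close> the
    value is \<open>min s t\<close>, the covariance of the increments.\<close>
  have cov_incr: "expectation (\<lambda>\<omega>. (B (t0 + s) \<omega> - B t0 \<omega>) * B t \<omega>) = min (t0 + s) t - min t0 t"
    if "s \<ge> 0" "t \<ge> 0" for s t
    using that V(2) assms(2) cov by (simp add: expectation_minus_mult)
  have "AE \<omega> in M. continuous_on {0..} (\<lambda>t. B (t0 + t) \<omega> - B t0 \<omega>)"
    using cont
  proof eventually_elim
    case (elim \<omega>)
    show ?case
      using assms(2) by (intro continuous_intros continuous_on_compose2[OF elim]) auto
  qed
  moreover have "expectation (\<lambda>\<omega>. (B (t0 + s) \<omega> - B t0 \<omega>) * (B (t0 + t) \<omega> - B t0 \<omega>)) = min s t"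
    if "s \<ge> 0" "t \<ge> 0" for s t
  proof -
    have "expectation (\<lambda>\<omega>. (B (t0 + t) \<omega> - B t0 \<omega>) * (B (t0 + s) \<omega> - B t0 \<omega>)) =
      expectation (\<lambda>\<omega>. (B (t0 + s) \<omega> - B t0 \<omega>) * B (t0 + t) \<omega>) - expectation (\<lambda>\<omega>. (B (t0 + s) \<omega> - B t0 \<omega>) * B t0 \<omega>)"
      using that V(2) assms(2) inV by (subst expectation_minus_mult) (auto simp: mult.commute)
    also have "\<dots> = min s t"
      using that assms(2) by (simp add: cov_incr min_def)
    finally show ?thesis by (simp add: mult.commute)
  qed
  ultimately show "brownian_motion (\<lambda>t \<omega>. B (t0 + t) \<omega> - B t0 \<omega>)"
    unfolding brownian_motion_iff using V(1) inV by blast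
  show "indep_processes {0..} (\<lambda>t \<omega>. B (t0 + t) \<omega> - B t0 \<omega>) {0..t0} B"
    unfolding indep_processes_def
    by (rule uncorrelated_imp_indep) (use inV V(2) cov_incr in auto)
qed

theorem proposition5p3:
  fixes M :: "'a measure" and B :: "real \<Rightarrow> 'a \<Rightarrow> real"
  assumes "prob_space M"
    and "prob_space.brownian_motion M B"
  shows "(\<forall>c>0. prob_space.brownian_motion M (\<lambda>t \<omega>. B (c * t) \<omega> / sqrt c)) \<and>
    (\<forall>t0\<ge>0. prob_space.brownian_motion M (\<lambda>t \<omega>. B (t0 + t) \<omega> - B t0 \<omega>) \<and>
       prob_space.indep_processes M {0..} (\<lambda>t \<omega>. B (t0 + t) \<omega> - B t0 \<omega>) {0..t0} B) \<and>
    prob_space.brownian_motion M (\<lambda>t \<omega>. if t = 0 then 0 else t * B (1 / t) \<omega>) \<and>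
    (AE \<omega> in M. ((\<lambda>t. B t \<omega> / t) \<longlongrightarrow> 0) at_top)"
proof -
  interpret prob_space M by fact
  show ?thesis
    using brownian_motion_scaling[OF assms(2)] brownian_motion_weak_markov[OF assms(2)]
      brownian_motion_time_inversion[OF assms(2)] by blast
qed

end
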